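(* Let $H,K,L$ be real or complex Hilbert spaces, let $A$ be a densely defined linear operator from $K$ to $L$ and $B$ a densely defined linear operator from $H$ to $K$. The following assertions are equivalent: (i) $\operatorname{dom}(AB)$ is dense in $H$ and $(AB)^*=B^*A^*$; (ii) $G(AB)^{\perp}\subseteq \operatorname{ran} M_{AB,\,B^*A^*}$.
   Context: Operators are (possibly unbounded) linear maps defined on a linear subspace; $\operatorname{dom}(AB)=\{x\in\operatorname{dom}B: Bx\in\operatorname{dom}A\}$, and similarly for $B^*A^*$. $G(AB)=\{(x,ABx): x\in\operatorname{dom}(AB)\}\subseteq H\times L$ is the graph, and $\perp$ denotes orthogonal complement in the product Hilbert space $H\times L$. For operators $S$ from $H$ to $L$ and $T$ from $L$ to $H$, $M_{S,T}$ is the operator in $H\times L$ with domain $\operatorname{dom}S\times\operatorname{dom}T$ given by $M_{S,T}(x,y)=(x-Ty,\;Sx+y)$. *)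

theory Defs
  imports "HOL-Analysis.Analysis"
begin

section \<open>The scalar fields\<close>

text \<open>
  A common class for the fields of real and of complex numbers. The two axioms force
  \<open>kcnj z = (norm z)\<^sup>2 / z\<close> for nonzero \<open>z\<close>, and each \<open>z\<close> is a root of the real polynomial
  \<open>X\<^sup>2 - (z + kcnj z) X + (norm z)\<^sup>2\<close>. Hence there are no other instances up to isomorphism; see
  \<open>real_or_complex_cases\<close> below.
\<close>

class real_or_complex = real_normed_field +
  fixes kcnj :: "'a \<Rightarrow> 'a"
  assumes kcnj_add: "kcnj (x + y) = kcnj x + kcnj y"
    and mult_kcnj_scaleR: "x * kcnj x = (norm x)\<^sup>2 *\<^sub>R 1"

lemma mult_kcnj: "x * kcnj x = of_real ((norm x)\<^sup>2)" for x :: "'a::real_or_complex"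
  by (simp add: mult_kcnj_scaleR of_real_def)

instantiation real :: real_or_complex
begin
definition kcnj_real :: "real \<Rightarrow> real" where "kcnj_real x = x"
instance by standard (simp_all add: kcnj_real_def power2_eq_square)
end

instantiation complex :: real_or_complex
begin
definition kcnj_complex :: "complex \<Rightarrow> complex" where "kcnj_complex = cnj"
instance by standard (simp_all add: kcnj_complex_def flip: of_real_def complex_norm_square)
end

lemma real_or_complex_cases:
  "(\<forall>z::'k::real_or_complex. z \<in> \<real>) \<or>
    (\<exists>i::'k. i * i = -1 \<and> (\<forall>z. \<exists>a b. z = of_real a + of_real b * i))"
proof -
  have one: "kcnj (1::'k) = 1"
    using mult_kcnj[of "1::'k"] by simp
  have quad: "\<exists>a c. (z - of_real a)^2 = of_real c" for z :: 'k
  proof -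
    have "(z + 1) * (kcnj z + 1) = of_real ((norm (z+1))\<^sup>2)"
      using mult_kcnj[of "z+1"] by (simp add: kcnj_add one)
    then have t: "z + kcnj z = of_real ((norm (z+1))\<^sup>2 - (norm z)\<^sup>2 - 1)"
      using mult_kcnj[of z] by (simp add: algebra_simps)
    define t where "t = (norm (z+1))\<^sup>2 - (norm z)\<^sup>2 - 1"
    have k: "kcnj z = of_real t - z"
      using t unfolding t_def[symmetric] by (simp add: algebra_simps)
    have q: "z * of_real t - z * z = of_real ((norm z)\<^sup>2)"
      using mult_kcnj[of z] unfolding k by (simp add: algebra_simps)
    have "(z - of_real (t/2))^2 = z * z - z * of_real t + of_real ((t/2)\<^sup>2)"
      by (simp add: power2_eq_square algebra_simps)
    also have "\<dots> = of_real ((t/2)\<^sup>2 - (norm z)\<^sup>2)"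
      unfolding of_real_diff q[symmetric] by simp
    finally show ?thesis by blast
  qed
  show ?thesis
  proof (cases "\<forall>z::'k. z \<in> \<real>")
    case False
    then obtain z :: 'k where z: "z \<notin> \<real>" by blast
    have sq: "w \<in> \<real>" if "w^2 = of_real c" "c \<ge> 0" for w :: 'k and c
    proof -
      have "w^2 = (of_real (sqrt c))^2"
        using that by (simp flip: of_real_power)
      then show ?thesis by (auto simp: power2_eq_iff)
    qed
    obtain a c where ac: "(z - of_real a)^2 = of_real c" using quad by blast
    have c: "c < 0"
    proof (rule ccontr)
      assume "\<not> c < 0"
      then have "z - of_real a \<in> \<real>" using sq ac by auto
      then have "(z - of_real a) + of_real a \<in> \<real>" by (intro Reals_add) auto
      with z show False by simp
    qed
    define i where "i = (z - of_real a) / of_real (sqrt (-c))"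
    have "i^2 = of_real c / of_real ((sqrt (-c))^2)"
      unfolding i_def power_divide ac by simp
    then have i: "i^2 = -1" using c by simp
    have "\<exists>a b. w = of_real a + of_real b * i" for w :: 'k
    proof -
      obtain d e where de: "(w - of_real d)^2 = of_real e" using quad by blast
      show ?thesis
      proof (cases "e \<ge> 0")
        case True
        then have "w - of_real d \<in> \<real>" using sq de by blast
        then have "(w - of_real d) + of_real d \<in> \<real>" by (intro Reals_add) auto
        then obtain r where "w = of_real r" by (auto elim: Reals_cases)
        then have "w = of_real r + of_real 0 * i" by simp
        then show ?thesis by blast
      next
        case False
        then have "(of_real (sqrt (-e)) * i)^2 = of_real e"
          by (simp add: power_mult_distrib i flip: of_real_power)
        then have "(w - of_real d)^2 = (of_real (sqrt (-e)) * i)^2" using de by simp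
        then consider "w - of_real d = of_real (sqrt (-e)) * i"
          | "w - of_real d = - (of_real (sqrt (-e)) * i)"
          by (auto simp: power2_eq_iff)
        then show ?thesis
        proof cases
          case 1
          then have "w = of_real d + of_real (sqrt (-e)) * i" by (simp add: algebra_simps)
          then show ?thesis by blast
        next
          case 2
          then have "w = of_real d + of_real (- sqrt (-e)) * i" by (simp add: algebra_simps)
          then show ?thesis by blast
        qed
      qed
    qed
    then show ?thesis using i by (auto simp: power2_eq_square)
  qed simp
qed


section \<open>Hilbert spaces\<close>

text \<open>
  The inner product is linear in its first argument. The class \<open>banach\<close> supplies the norm, its
  completeness and the topology; the last two axioms say that this is the norm induced by the
  inner product, and that the real structure underlying it is the restriction of the given scalar
  multiplication. Positive definiteness is part of \<open>ip_self\<close>.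
\<close>

locale hilbert_space = vector_space scale
  for scale :: "'k::real_or_complex \<Rightarrow> 'a::banach \<Rightarrow> 'a" +
  fixes ip :: "'a \<Rightarrow> 'a \<Rightarrow> 'k"
  assumes ip_add_left: "ip (x + y) z = ip x z + ip y z"
    and ip_scale_left: "ip (scale c x) y = c * ip x y"
    and ip_commute: "ip y x = kcnj (ip x y)"
    and ip_self: "ip x x = of_real ((norm x)\<^sup>2)"
    and scale_of_real: "scale (of_real r) x = r *\<^sub>R x"

lemma hilbert_space_real:
  "hilbert_space (scaleR :: real \<Rightarrow> 'a \<Rightarrow> 'a::{real_inner, banach}) inner"
  by unfold_locales
    (simp_all add: algebra_simps kcnj_real_def inner_commute power2_norm_eq_inner)

definition prod_scale ::
  "('k \<Rightarrow> 'a \<Rightarrow> 'a) \<Rightarrow> ('k \<Rightarrow> 'b \<Rightarrow> 'b) \<Rightarrow> 'k \<Rightarrow> 'a \<times> 'b \<Rightarrow> 'a \<times> 'b" where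
  "prod_scale sa sb c z = (sa c (fst z), sb c (snd z))"

definition prod_ip ::
  "('a \<Rightarrow> 'a \<Rightarrow> 'k::plus) \<Rightarrow> ('b \<Rightarrow> 'b \<Rightarrow> 'k) \<Rightarrow> 'a \<times> 'b \<Rightarrow> 'a \<times> 'b \<Rightarrow> 'k" where
  "prod_ip ipa ipb z w = ipa (fst z) (fst w) + ipb (snd z) (snd w)"

lemma hilbert_space_prod:
  assumes "hilbert_space sa ipa" "hilbert_space sb ipb"
  shows "hilbert_space (prod_scale sa sb) (prod_ip ipa ipb)"
proof -
  interpret a: hilbert_space sa ipa by fact
  interpret b: hilbert_space sb ipb by fact
  show ?thesis
  proof unfold_locales
    fix x y :: "'b \<times> 'c"
    show "prod_ip ipa ipb y x = kcnj (prod_ip ipa ipb x y)"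
      using a.ip_commute[of "fst y" "fst x"] b.ip_commute[of "snd y" "snd x"]
      by (simp add: prod_ip_def kcnj_add)
  qed (simp_all add: prod_scale_def prod_ip_def a.scale_right_distrib b.scale_right_distrib
      a.scale_left_distrib b.scale_left_distrib a.ip_add_left b.ip_add_left a.ip_scale_left
      b.ip_scale_left a.ip_self b.ip_self a.scale_of_real b.scale_of_real norm_prod_def
      distrib_left scaleR_prod_def)
qed

definition orth_compl :: "('a \<Rightarrow> 'a \<Rightarrow> 'k::zero) \<Rightarrow> 'a set \<Rightarrow> 'a set" where
  "orth_compl ip S = {z. \<forall>w\<in>S. ip z w = 0}"


section \<open>Operators\<close>

text \<open>
  An operator with its domain is a partial map \<open>T :: 'a \<rightharpoonup> 'b\<close>, so that equality of operators
  includes equality of domains. Domain, range and graph are \<open>dom\<close>, \<open>ran\<close> and \<open>Map.graph\<close>, and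
  the product \<open>AB\<close> on its natural domain is \<open>A \<circ>\<^sub>m B\<close> (\<open>dom_prod\<close>).
\<close>

lemma dom_prod: "dom (A \<circ>\<^sub>m B) = {x \<in> dom B. the (B x) \<in> dom A}"
  by (auto simp: map_comp_def split: option.splits)

definition linear_operator ::
  "('k::field \<Rightarrow> 'a::ab_group_add \<Rightarrow> 'a) \<Rightarrow> ('k \<Rightarrow> 'b::ab_group_add \<Rightarrow> 'b) \<Rightarrow> ('a \<rightharpoonup> 'b) \<Rightarrow> bool"
where
  "linear_operator sa sb T \<longleftrightarrow>
    module.subspace sa (dom T) \<and>
    (\<forall>x\<in>dom T. \<forall>y\<in>dom T. the (T (x + y)) = the (T x) + the (T y)) \<and>
    (\<forall>c. \<forall>x\<in>dom T. the (T (sa c x)) = sb c (the (T x)))"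

definition densely_defined :: "('a::topological_space \<rightharpoonup> 'b) \<Rightarrow> bool" where
  "densely_defined T \<longleftrightarrow> closure (dom T) = UNIV"

text \<open>
  The vector \<open>z\<close> below is unique if \<open>T\<close> is densely defined; the adjoint is only meant for
  such \<open>T\<close>.
\<close>

definition op_adjoint ::
  "('a \<Rightarrow> 'a \<Rightarrow> 'k) \<Rightarrow> ('b \<Rightarrow> 'b \<Rightarrow> 'k) \<Rightarrow> ('a \<rightharpoonup> 'b) \<Rightarrow> ('b \<rightharpoonup> 'a)" where
  "op_adjoint ipa ipb T y =
    (if \<exists>z. \<forall>x\<in>dom T. ipb (the (T x)) y = ipa x z
     then Some (THE z. \<forall>x\<in>dom T. ipb (the (T x)) y = ipa x z)
     else None)"

definition M_op ::
  "('a::ab_group_add \<rightharpoonup> 'b::ab_group_add) \<Rightarrow> ('b \<rightharpoonup> 'a) \<Rightarrow> ('a \<times> 'b \<rightharpoonup> 'a \<times> 'b)" where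
  "M_op S T = (\<lambda>(x, y).
    if x \<in> dom S \<and> y \<in> dom T then Some (x - the (T y), the (S x) + y) else None)"

end

theory Submission
  imports Defs
begin

text \<open>
  Write \<open>S = AB\<close> and \<open>T = B\<^sup>*A\<^sup>*\<close>. They form a dual pair, \<open>\<langle>S x, y\<rangle> = \<langle>x, T y\<rangle>\<close>, so every
  \<open>(- T y, y)\<close> is orthogonal to \<open>G(S)\<close>. If \<open>(u, v) = (x - T y, S x + y)\<close> is orthogonal to \<open>G(S)\<close>,
  then so is \<open>(x, S x) = (u, v) - (- T y, y)\<close>, which lies in \<open>G(S)\<close> and hence vanishes. Thus (ii)
  says that every element of the complement of \<open>G(S)\<close> has the form \<open>(- T y, y)\<close>. Applied to
  \<open>(u, 0)\<close> this gives density of the domain of \<open>S\<close>, and then it says that \<open>S\<^sup>* = T\<close>.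
\<close>

section \<open>Conjugation on the scalar field\<close>

lemma kcnj_of_real: "kcnj (of_real r :: 'k::real_or_complex) = of_real r"
proof (cases "r = 0")
  case True
  then show ?thesis
    using kcnj_add[of "0::'k" 0] by simp
next
  case False
  then show ?thesis
    \<comment> \<open>Away from zero the product axiom determines the conjugate by division; at zero
      it says nothing, and additivity was used instead.\<close>
    using mult_kcnj[of "of_real r :: 'k"] by (simp add: power2_eq_square)
qed

lemma kcnj_zero [simp]: "kcnj (0::'k::real_or_complex) = 0"
  using kcnj_of_real[of 0, where 'k='k] by simp

lemma norm_kcnj [simp]: "norm (kcnj z) = norm (z::'k::real_or_complex)"
proof (cases "z = 0")
  case False
  have "norm z * norm (kcnj z) = norm z * norm z"
    using arg_cong[OF mult_kcnj[of z], of norm] by (simp add: norm_mult power2_eq_square)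
  then show ?thesis
    using False by simp
qed simp

section \<open>Elementary geometry of the inner product\<close>

context hilbert_space
begin

lemma ip_add_right: "ip x (y + z) = ip x y + ip x z"
  by (metis ip_add_left ip_commute kcnj_add)

lemma ip_zero_left [simp]: "ip 0 x = 0"
  using ip_add_left[of 0 0 x] by simp

lemma ip_zero_right [simp]: "ip x 0 = 0"
  using ip_add_right[of x 0 0] by simp

lemma ip_minus_left [simp]: "ip (- x) y = - ip x y"
  using ip_add_left[of x "- x" y] by (simp add: eq_neg_iff_add_eq_0 add.commute)

lemma ip_minus_right [simp]: "ip x (- y) = - ip x y"
  using ip_add_right[of x y "- y"] by (simp add: eq_neg_iff_add_eq_0 add.commute)

lemma ip_diff_left: "ip (x - y) z = ip x z - ip y z"
  using ip_add_left[of x "- y" z] by simp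

lemma ip_diff_right: "ip x (y - z) = ip x y - ip x z"
  using ip_add_right[of x y "- z"] by simp

lemma ip_eq_0_commute: "ip x y = 0 \<longleftrightarrow> ip y x = 0"
  by (metis ip_commute kcnj_zero)

lemma ip_self_eq_0_iff: "ip x x = 0 \<longleftrightarrow> x = 0"
  by (simp add: ip_self)

text \<open>The norm is a priori homogeneous only for real scalars. Expanding
  \<open>ip (scale c x) (scale c x)\<close> leaves the conjugate of a product, which taking norms
  removes by \<open>norm_kcnj\<close>.\<close>

lemma norm_scale: "norm (scale c x) = norm c * norm x"
proof -
  have "of_real ((norm (scale c x))\<^sup>2) = c * kcnj (c * ip x x)"
    by (metis ip_commute ip_scale_left ip_self)
  then have "norm (of_real ((norm (scale c x))\<^sup>2) :: 'k) = norm (c * kcnj (c * ip x x))"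
    by simp
  then have "(norm (scale c x))\<^sup>2 = (norm c * norm x)\<^sup>2"
    by (simp add: norm_mult ip_self power2_eq_square)
  then show ?thesis
    by simp
qed

lemma norm_diff_square:
  "of_real ((norm (x - y))\<^sup>2) = of_real ((norm x)\<^sup>2 + (norm y)\<^sup>2) - ip x y - ip y x"
proof -
  have "ip (x - y) (x - y) = ip x x + ip y y - ip x y - ip y x"
    by (simp add: ip_diff_left ip_diff_right)
  then show ?thesis
    by (simp add: ip_self)
qed

lemma parallelogram_law:
  fixes x y :: 'a
  shows "(norm (x + y))\<^sup>2 + (norm (x - y))\<^sup>2 = 2 * (norm x)\<^sup>2 + 2 * (norm y)\<^sup>2"
proof -
  have "ip (x + y) (x + y) + ip (x - y) (x - y) = 2 * ip x x + 2 * ip y y"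
    by (simp add: ip_add_left ip_add_right ip_diff_left ip_diff_right)
  then have "(of_real ((norm (x + y))\<^sup>2 + (norm (x - y))\<^sup>2) :: 'k)
      = of_real (2 * (norm x)\<^sup>2 + 2 * (norm y)\<^sup>2)"
    by (simp add: ip_self)
  then show ?thesis
    by (simp only: of_real_eq_iff)
qed

lemma norm_diff_square_orth:
  assumes "ip x y = 0"
  shows "(norm (x - y))\<^sup>2 = (norm x)\<^sup>2 + (norm y)\<^sup>2"
proof -
  have "(of_real ((norm (x - y))\<^sup>2) :: 'k) = of_real ((norm x)\<^sup>2 + (norm y)\<^sup>2)"
    using norm_diff_square[of x y] assms ip_eq_0_commute[of x y] by simp
  then show ?thesis
    by (simp only: of_real_eq_iff)
qed

section \<open>Orthogonality, nearest points and density\<close>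

lemma orth_dense_eq_0:
  assumes "closure M = UNIV" and "\<And>x. x \<in> M \<Longrightarrow> ip x z = 0"
  shows "z = 0"
proof (rule ccontr)
  assume "z \<noteq> 0"
  then obtain x where x: "x \<in> M" "dist x z < norm z"
    by (metis UNIV_I assms(1) closure_approachable zero_less_norm_iff)
  \<comment> \<open>By Pythagoras a vector orthogonal to \<open>z\<close> is at least as far from
    \<open>z\<close> as the origin is, so none comes closer than \<open>norm z\<close>.\<close>
  have "(norm z)\<^sup>2 \<le> (norm (x - z))\<^sup>2"
    using norm_diff_square_orth[of x z] assms(2) x(1) by simp
  then have "norm z \<le> norm (x - z)"
    by (rule power2_le_imp_le) simp
  with x(2) show False
    by (simp add: dist_norm)
qed

text \<open>If \<open>ip m w\<close> were nonzero, subtracting the component of \<open>w\<close>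
  along \<open>m\<close> would strictly shorten \<open>w\<close>: the squared norm drops by
  \<open>a\<^sup>2 / (norm m)\<^sup>2\<close>.\<close>

lemma orth_if_norm_minimal:
  assumes min: "\<And>c. norm w \<le> norm (w - scale c m)"
  shows "ip m w = 0"
proof (rule ccontr)
  assume "ip m w \<noteq> 0"
  define a where "a = norm (ip m w)"
  have a: "a > 0"
    using \<open>ip m w \<noteq> 0\<close> by (simp add: a_def)
  have m: "m \<noteq> 0"
    using \<open>ip m w \<noteq> 0\<close> by auto
  \<comment> \<open>This \<open>c\<close> minimises the distance from \<open>w\<close> to the line spanned by \<open>m\<close>.\<close>
  define t where "t = 1 / (norm m)\<^sup>2"
  define c where "c = of_real t * kcnj (ip m w)"
  have 1: "ip (scale c m) w = of_real (t * a\<^sup>2)"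
    using mult_kcnj[of "ip m w"] by (simp add: ip_scale_left c_def a_def mult.commute)
  have 2: "ip w (scale c m) = of_real (t * a\<^sup>2)"
    by (metis 1 ip_commute kcnj_of_real)
  have "(of_real ((norm (w - scale c m))\<^sup>2) :: 'k)
      = of_real ((norm w)\<^sup>2 + (norm (scale c m))\<^sup>2 - 2 * (t * a\<^sup>2))"
    using norm_diff_square[of w "scale c m"] unfolding 1 2 by simp
  then have "(norm (w - scale c m))\<^sup>2 = (norm w)\<^sup>2 + (norm (scale c m))\<^sup>2 - 2 * (t * a\<^sup>2)"
    by (simp only: of_real_eq_iff)
  also have "(norm (scale c m))\<^sup>2 = t * a\<^sup>2"
    using m by (simp add: norm_scale c_def t_def norm_mult norm_divide a_def power2_eq_square field_simps)
  finally have "(norm (w - scale c m))\<^sup>2 < (norm w)\<^sup>2"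
    using a m by (simp add: t_def)
  with power_mono[OF min[of c] norm_ge_zero, of 2] show False
    by (meson not_less)
qed

text \<open>The midpoint of \<open>p i\<close> and \<open>p j\<close> lies in \<open>M\<close>, so
  its distance from \<open>x\<close> is at least \<open>d\<close>. The parallelogram law then forces
  \<open>p i - p j\<close> to be small.\<close>

lemma Cauchy_if_minimizing:
  assumes M: "subspace M" and p: "\<And>n. p n \<in> M"
    and d: "\<And>m. m \<in> M \<Longrightarrow> d \<le> norm (x - m)" "0 \<le> d"
    and lim: "(\<lambda>n. norm (x - p n)) \<longlonglongrightarrow> d"
  shows "Cauchy p"
proof (rule CauchyI)
  fix e :: real
  assume e: "e > 0"
  have "(\<lambda>n. (norm (x - p n))\<^sup>2) \<longlonglongrightarrow> d\<^sup>2"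
    by (intro tendsto_intros lim)
  \<comment> \<open>The slack \<open>e\<^sup>2 / 4\<close> enters the parallelogram law four times,
    which leaves exactly \<open>e\<^sup>2\<close> after \<open>4 * d\<^sup>2\<close>
    cancels.\<close>
  then have "\<forall>\<^sub>F n in sequentially. (norm (x - p n))\<^sup>2 < d\<^sup>2 + e\<^sup>2 / 4"
    by (rule order_tendstoD) (use e in simp)
  then obtain N where N: "\<And>n. n \<ge> N \<Longrightarrow> (norm (x - p n))\<^sup>2 < d\<^sup>2 + e\<^sup>2 / 4"
    by (auto simp: eventually_sequentially)
  have "norm (p i - p j) < e" if "i \<ge> N" "j \<ge> N" for i j
  proof -
    \<comment> \<open>The midpoint is written with the scalar multiplication of the space, for which
      \<open>M\<close> is closed; \<open>scale_of_real\<close> identifies it with the real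
      midpoint.\<close>
    define q where "q = scale (of_real (1/2)) (p i + p j)"
    have "q \<in> M"
      unfolding q_def by (intro subspace_scale subspace_add M p)
    have "(x - p i) + (x - p j) = 2 *\<^sub>R (x - q)"
      by (simp add: q_def scale_of_real algebra_simps scaleR_2 del: of_real_divide)
    then have "norm ((x - p i) + (x - p j)) = 2 * norm (x - q)"
      by simp
    then have "4 * d\<^sup>2 \<le> (norm ((x - p i) + (x - p j)))\<^sup>2"
      using power_mono[OF d(1)[OF \<open>q \<in> M\<close>] d(2), of 2] by (simp add: power_mult_distrib)
    then have "(norm ((x - p i) - (x - p j)))\<^sup>2 < e\<^sup>2"
      using parallelogram_law[of "x - p i" "x - p j"] N[OF that(1)] N[OF that(2)] by linarith
    then have "norm ((x - p i) - (x - p j)) < e"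
      using e by (simp add: power2_less_imp_less)
    then show ?thesis
      by (simp add: norm_minus_commute)
  qed
  then show "\<exists>N. \<forall>i\<ge>N. \<forall>j\<ge>N. norm (p i - p j) < e"
    by blast
qed

text \<open>A point \<open>x\<close> outside the closure has a nearest point \<open>l\<close> in the
  closure, obtained by completeness. Then \<open>x - l\<close> is orthogonal to \<open>M\<close>,
  hence zero, which puts \<open>x\<close> in the closure.\<close>

lemma dense_if_orth_trivial:
  assumes M: "subspace M" and triv: "\<And>z. (\<And>m. m \<in> M \<Longrightarrow> ip m z = 0) \<Longrightarrow> z = 0"
  shows "closure M = UNIV"
proof (rule ccontr)
  assume "closure M \<noteq> UNIV"
  then obtain x where x: "x \<notin> closure M"
    by blast
  \<comment> \<open>The infimum formula for \<open>infdist\<close> holds only for nonempty sets; on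
    the empty set its value is 0 by convention.\<close>
  have ne: "M \<noteq> {}"
    using subspace_0[OF M] by blast
  define d where "d = infdist x M"
  have d: "d \<le> norm (x - m)" if "m \<in> M" for m
    using infdist_le[OF that, of x] by (simp add: d_def dist_norm)
  have "\<exists>m\<in>M. norm (x - m) < d + 1 / real (Suc n)" for n
  proof (rule ccontr)
    assume "\<not> ?thesis"
    then have "d + 1 / real (Suc n) \<le> infdist x M"
      unfolding infdist_notempty[OF ne] by (intro cINF_greatest ne) (auto simp: dist_norm not_less)
    then show False
      by (simp add: d_def)
  qed
  then obtain p where p: "\<And>n. p n \<in> M" "\<And>n. norm (x - p n) < d + 1 / real (Suc n)"
    by metis
  have "(\<lambda>n. d + 1 / real (Suc n)) \<longlonglongrightarrow> d + 0"
    by (intro tendsto_add tendsto_const LIMSEQ_Suc[OF lim_1_over_n])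
  then have upper: "(\<lambda>n. d + 1 / real (Suc n)) \<longlonglongrightarrow> d"
    by simp
  have lim: "(\<lambda>n. norm (x - p n)) \<longlonglongrightarrow> d"
    by (rule tendsto_sandwich[OF _ _ tendsto_const upper])
      (intro always_eventually allI d p(1) less_imp_le[OF p(2)])+
  have "Cauchy p"
    using M p(1) d lim by (intro Cauchy_if_minimizing) (auto simp: d_def infdist_nonneg)
  then obtain l where l: "p \<longlonglongrightarrow> l"
    by (auto simp: Cauchy_convergent_iff convergent_def)
  have "(\<lambda>n. norm (x - p n)) \<longlonglongrightarrow> norm (x - l)"
    by (intro tendsto_intros l)
  then have dl: "norm (x - l) = d"
    using lim LIMSEQ_unique by blast
  have "ip m (x - l) = 0" if m: "m \<in> M" for m
  proof (rule orth_if_norm_minimal)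
    fix c
    have "(\<lambda>n. norm (x - p n - scale c m)) \<longlonglongrightarrow> norm (x - l - scale c m)"
      by (intro tendsto_intros l)
    \<comment> \<open>The limit \<open>l\<close> may lie outside \<open>M\<close>, so the lower
      bound is tested at the points \<open>p n + scale c m\<close> of \<open>M\<close> and carried
      to the limit.\<close>
    moreover have "d \<le> norm (x - p n - scale c m)" for n
      using d[of "p n + scale c m"] M p(1) m
      by (simp add: subspace_add subspace_scale diff_diff_eq)
    ultimately show "norm (x - l) \<le> norm (x - l - scale c m)"
      unfolding dl by (intro LIMSEQ_le_const) auto
  qed
  then have "x - l = 0"
    by (rule triv)
  moreover have "l \<in> closure M"
    using p(1) l closure_sequential by blast
  ultimately show False
    using x by simp
qed

section \<open>Adjoints of densely defined operators\<close>

lemma op_adjoint_eq_Some_iff: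
  assumes "densely_defined T"
  shows "op_adjoint ip ip' T y = Some z \<longleftrightarrow> (\<forall>x\<in>dom T. ip' (the (T x)) y = ip x z)"
proof -
  define P where "P z \<longleftrightarrow> (\<forall>x\<in>dom T. ip' (the (T x)) y = ip x z)" for z
  \<comment> \<open>Two candidates differ by a vector orthogonal to the dense domain; uniqueness is
    what allows the definite description to be eliminated.\<close>
  have uniq: "z = z'" if "P z" "P z'" for z z'
  proof -
    have "z - z' = 0"
      by (rule orth_dense_eq_0[of "dom T"])
        (use assms that in \<open>simp_all add: densely_defined_def ip_diff_right P_def\<close>)
    then show ?thesis
      by simp
  qed
  then have "(THE z. P z) = z" if "P z" for z
    using that by (intro the_equality)
  then have "(if \<exists>z. P z then Some (THE z. P z) else None) = Some z \<longleftrightarrow> P z"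
    by auto
  then show ?thesis
    unfolding op_adjoint_def P_def .
qed

lemma op_adjoint_zero:
  assumes "hilbert_space sc' ip'" and "densely_defined T"
  shows "op_adjoint ip ip' T 0 = Some 0"
proof -
  interpret b: hilbert_space sc' ip' by fact
  show ?thesis
    using assms(2) by (simp add: op_adjoint_eq_Some_iff)
qed

end

section \<open>Products, graphs and the range of \<open>M_op\<close>\<close>

lemma linear_operator_zero:
  assumes "vector_space sa" "vector_space sb" "linear_operator sa sb T"
  shows "T 0 = Some 0"
proof -
  interpret a: vector_space sa by fact
  interpret b: vector_space sb by fact
  have 0: "0 \<in> dom T"
    using assms(3) a.subspace_0 by (auto simp: linear_operator_def)
  then have "the (T (sa 0 0)) = sb 0 (the (T 0))"
    using assms(3) unfolding linear_operator_def by blast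
  with 0 show ?thesis
    by auto
qed

text \<open>Needed because the density criterion \<open>dense_if_orth_trivial\<close> applies to
  subspaces.\<close>

lemma subspace_dom_map_comp:
  assumes "vector_space sa" "vector_space sb"
    and "linear_operator sb sc A" "linear_operator sa sb B"
  shows "module.subspace sa (dom (A \<circ>\<^sub>m B))"
proof -
  interpret a: vector_space sa by fact
  interpret b: vector_space sb by fact
  have A: "b.subspace (dom A)" and B: "a.subspace (dom B)"
    using assms(3,4) by (auto simp: linear_operator_def)
  have Badd: "the (B (x + y)) = the (B x) + the (B y)" if "x \<in> dom B" "y \<in> dom B" for x y
    using assms(4) that unfolding linear_operator_def by blast
  have Bscale: "the (B (sa c x)) = sb c (the (B x))" if "x \<in> dom B" for c x
    using assms(4) that unfolding linear_operator_def by blast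
  have "0 \<in> dom (A \<circ>\<^sub>m B)"
    using linear_operator_zero[OF assms(1,2,4)] b.subspace_0[OF A] by (auto simp: dom_prod)
  moreover have "x + y \<in> dom (A \<circ>\<^sub>m B)" if "x \<in> dom (A \<circ>\<^sub>m B)" "y \<in> dom (A \<circ>\<^sub>m B)" for x y
    using that a.subspace_add[OF B] b.subspace_add[OF A] Badd unfolding dom_prod by simp
  moreover have "sa c x \<in> dom (A \<circ>\<^sub>m B)" if "x \<in> dom (A \<circ>\<^sub>m B)" for c x
    using that a.subspace_scale[OF B] b.subspace_scale[OF A] Bscale unfolding dom_prod by simp
  ultimately show ?thesis
    by (simp add: a.subspace_def)
qed

text \<open>The right-hand side is the equation defining the adjoint of \<open>S\<close> at
  \<open>v\<close> with value \<open>- u\<close>. It is stated without density of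
  \<open>dom S\<close>, because the range condition has to yield that density first.\<close>

lemma orth_compl_graph_iff:
  assumes "hilbert_space sa ipa" "hilbert_space sb ipb"
  shows "(u, v) \<in> orth_compl (prod_ip ipa ipb) (Map.graph S) \<longleftrightarrow>
    (\<forall>x\<in>dom S. ipb (the (S x)) v = ipa x (- u))"
proof -
  interpret a: hilbert_space sa ipa by fact
  interpret b: hilbert_space sb ipb by fact
  interpret p: hilbert_space "prod_scale sa sb" "prod_ip ipa ipb"
    using assms by (rule hilbert_space_prod)
  have "(u, v) \<in> orth_compl (prod_ip ipa ipb) (Map.graph S) \<longleftrightarrow>
      (\<forall>w\<in>Map.graph S. prod_ip ipa ipb w (u, v) = 0)"
    by (simp add: orth_compl_def p.ip_eq_0_commute)
  also have "\<dots> \<longleftrightarrow> (\<forall>x\<in>dom S. ipb (the (S x)) v = ipa x (- u))"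
    by (auto simp: Map.graph_def prod_ip_def dom_def eq_neg_iff_add_eq_0 add.commute)
  finally show ?thesis .
qed

text \<open>Moving \<open>A\<close> and then \<open>B\<close> across the inner product gives the
  inclusion of the product of adjoints in the adjoint of the product, as an identity that makes
  sense before \<open>dom (A \<circ>\<^sub>m B)\<close> is known to be dense.\<close>

lemma adjoint_comp_dual_pair:
  assumes "hilbert_space sH ipH" "hilbert_space sK ipK"
    and "densely_defined A" "densely_defined B"
    and "(op_adjoint ipH ipK B \<circ>\<^sub>m op_adjoint ipK ipL A) y = Some z"
    and "x \<in> dom (A \<circ>\<^sub>m B)"
  shows "ipL (the ((A \<circ>\<^sub>m B) x)) y = ipH x z"
proof -
  interpret H: hilbert_space sH ipH by fact
  interpret K: hilbert_space sK ipK by fact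
  obtain k where k: "op_adjoint ipK ipL A y = Some k" "op_adjoint ipH ipK B k = Some z"
    using assms(5) by (auto simp: map_comp_Some_iff)
  have "x \<in> dom B" "the (B x) \<in> dom A"
    using assms(6) by (simp_all add: dom_prod)
  then obtain b where b: "B x = Some b" "b \<in> dom A"
    by (metis domD option.sel)
  have "ipL (the (A b)) y = ipK b k"
    using k(1) b(2) by (simp add: K.op_adjoint_eq_Some_iff[OF assms(3)])
  moreover have "ipK (the (B x)) k = ipH x z"
    using k(2) \<open>x \<in> dom B\<close> by (simp add: H.op_adjoint_eq_Some_iff[OF assms(4)])
  ultimately show ?thesis
    using b(1) by (simp add: map_comp_def)
qed

lemma ran_M_op_iff:
  "(u, v) \<in> ran (M_op S T) \<longleftrightarrow>
    (\<exists>x y sx ty. S x = Some sx \<and> T y = Some ty \<and> u = x - ty \<and> v = sx + y)"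
  by (force simp: ran_def M_op_def split: if_splits)

theorem theorem2p2:
  fixes sH :: "'k::real_or_complex \<Rightarrow> 'h::banach \<Rightarrow> 'h"
    and ipH :: "'h \<Rightarrow> 'h \<Rightarrow> 'k"
    and sK :: "'k \<Rightarrow> 'm::banach \<Rightarrow> 'm"
    and ipK :: "'m \<Rightarrow> 'm \<Rightarrow> 'k"
    and sL :: "'k \<Rightarrow> 'l::banach \<Rightarrow> 'l"
    and ipL :: "'l \<Rightarrow> 'l \<Rightarrow> 'k"
    and A :: "'m \<rightharpoonup> 'l"
    and B :: "'h \<rightharpoonup> 'm"
  assumes "hilbert_space sH ipH"
    and "hilbert_space sK ipK"
    and "hilbert_space sL ipL"
    and "linear_operator sK sL A" and "densely_defined A"
    and "linear_operator sH sK B" and "densely_defined B"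
  shows "densely_defined (A \<circ>\<^sub>m B) \<and>
      op_adjoint ipH ipL (A \<circ>\<^sub>m B) = op_adjoint ipH ipK B \<circ>\<^sub>m op_adjoint ipK ipL A
    \<longleftrightarrow>
      orth_compl (prod_ip ipH ipL) (Map.graph (A \<circ>\<^sub>m B))
        \<subseteq> ran (M_op (A \<circ>\<^sub>m B) (op_adjoint ipH ipK B \<circ>\<^sub>m op_adjoint ipK ipL A))"
proof -
  interpret H: hilbert_space sH ipH by fact
  interpret K: hilbert_space sK ipK by fact
  interpret L: hilbert_space sL ipL by fact
  interpret HL: hilbert_space "prod_scale sH sL" "prod_ip ipH ipL"
    by (intro hilbert_space_prod assms)
  define S where "S = A \<circ>\<^sub>m B"
  define T where "T = op_adjoint ipH ipK B \<circ>\<^sub>m op_adjoint ipK ipL A"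
  let ?G = "orth_compl (prod_ip ipH ipL) (Map.graph S)"
  have sub: "H.subspace (dom S)"
    unfolding S_def
    by (rule subspace_dom_map_comp[OF H.vector_space_axioms K.vector_space_axioms assms(4,6)])
  have S0: "S 0 = Some 0"
    using linear_operator_zero[OF H.vector_space_axioms K.vector_space_axioms assms(6)]
      linear_operator_zero[OF K.vector_space_axioms L.vector_space_axioms assms(4)]
    by (simp add: S_def)
  have T0: "T 0 = Some 0"
    using H.op_adjoint_zero[OF assms(2,7)] K.op_adjoint_zero[OF assms(3,5)] by (simp add: T_def)
  have dual: "ipL (the (S x)) y = ipH x z" if "T y = Some z" "x \<in> dom S" for x y z
    using adjoint_comp_dual_pair[OF assms(1,2,5,7)] that unfolding S_def T_def by blast
  note G_iff = orth_compl_graph_iff[OF assms(1,3)]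
  have "densely_defined S \<and> op_adjoint ipH ipL S = T \<longleftrightarrow> ?G \<subseteq> ran (M_op S T)"
  proof
    assume adj: "densely_defined S \<and> op_adjoint ipH ipL S = T"
    have T: "T v = Some z \<longleftrightarrow> (\<forall>x\<in>dom S. ipL (the (S x)) v = ipH x z)" for v z
      using H.op_adjoint_eq_Some_iff[of S ipL] adj by simp
    show "?G \<subseteq> ran (M_op S T)"
    proof (rule subsetI, clarify)
      fix u v
      assume "(u, v) \<in> ?G"
      then have "T v = Some (- u)"
        by (simp only: G_iff T)
      \<comment> \<open>The preimage under \<open>M_op S T\<close> is \<open>(0, v)\<close>.\<close>
      then have "S 0 = Some 0 \<and> T v = Some (- u) \<and> u = 0 - (- u) \<and> v = 0 + v"
        using S0 by simp
      then show "(u, v) \<in> ran (M_op S T)"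
        unfolding ran_M_op_iff by blast
    qed
  next
    assume ran: "?G \<subseteq> ran (M_op S T)"
    \<comment> \<open>Together with \<open>dual\<close> this makes \<open>T\<close> the solution map
      of the adjoint equation, still without density of \<open>dom S\<close>.\<close>
    have T_if: "T v = Some z" if adj: "\<forall>x\<in>dom S. ipL (the (S x)) v = ipH x z" for v z
    proof -
      have mem: "(- z, v) \<in> ?G"
        using adj by (simp add: G_iff)
      then have "(- z, v) \<in> ran (M_op S T)"
        using ran by blast
      then obtain x y sx ty where xy: "S x = Some sx" "T y = Some ty" "- z = x - ty" "v = sx + y"
        unfolding ran_M_op_iff by blast
      have "(- ty, y) \<in> ?G"
        using dual[OF xy(2)] by (simp add: G_iff)
      have graph: "(x, sx) \<in> Map.graph S"
        using xy(1) by (simp add: in_graphI)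
      have "(x, sx) = (- z, v) - (- ty, y)"
        using xy by simp
      then have "prod_ip ipH ipL (x, sx) (x, sx) =
          prod_ip ipH ipL (- z, v) (x, sx) - prod_ip ipH ipL (- ty, y) (x, sx)"
        by (metis HL.ip_diff_left)
      also have "\<dots> = 0"
        using mem \<open>(- ty, y) \<in> ?G\<close> graph by (simp add: orth_compl_def)
      finally have "x = 0" "sx = 0"
        by (simp_all add: HL.ip_self_eq_0_iff zero_prod_def)
      with xy show ?thesis
        by simp
    qed
    have "closure (dom S) = UNIV"
    proof (rule H.dense_if_orth_trivial[OF sub])
      fix z
      assume "\<And>x. x \<in> dom S \<Longrightarrow> ipH x z = 0"
      \<comment> \<open>At \<open>v = 0\<close> the adjoint equation asks only that \<open>z\<close>
        be orthogonal to \<open>dom S\<close>. Since \<open>T\<close> is single-valued and sends 0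
        to 0, such a \<open>z\<close> vanishes.\<close>
      then have "T 0 = Some z"
        by (intro T_if) simp
      with T0 show "z = 0"
        by simp
    qed
    then have dense: "densely_defined S"
      by (simp add: densely_defined_def)
    have "op_adjoint ipH ipL S v = Some z \<longleftrightarrow> T v = Some z" for v z
      unfolding H.op_adjoint_eq_Some_iff[OF dense] using T_if dual by blast
    \<comment> \<open>Partial maps with the same defined values also have the same domain, so
      agreement on every \<open>Some z\<close> gives equality.\<close>
    then have "op_adjoint ipH ipL S = T"
      by (intro ext) (metis option.exhaust)
    with dense show "densely_defined S \<and> op_adjoint ipH ipL S = T" ..
  qed
  then show ?thesis
    unfolding S_def T_def .
qed

end
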